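(* Let $n \ge 1$, let $S \subseteq \mathbb{Z}_2^n$ be any subset, and let $G=\Gamma(\mathbb{Z}_2^n,S)$ be the Cayley graph of $\mathbb{Z}_2^n$ with respect to $S$. Then for every subset $U \subseteq \mathbb{Z}_2^n$ with $|U| > 2^{n-1}$, the maximum degree $\Delta(H)$ of the induced subgraph $H$ of $G$ on $U$ satisfies $\Delta(H) \ge \sqrt{|S|}$.
   Context: For $S \subseteq \mathbb{Z}_2^n$, the Cayley graph $\Gamma(\mathbb{Z}_2^n,S)$ has vertex set $\mathbb{Z}_2^n$ and edge set consisting of all unordered pairs $\{g,g+s\}$ with $g\in\mathbb{Z}_2^n$, $s\in S$. The set $S$ is called the generating set of the Cayley graph, but it is not required to span $\mathbb{Z}_2^n$. The degree of $u \in U$ in $H$ is the number of $s\in S$ with $u+s\in U$. *)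

theory Defs
  imports "HOL-Analysis.Analysis" "HOL-Library.Z2"
begin

text \<open>
  The group of binary vectors of length \<open>n\<close> is \<open>bit ^ 'n\<close>, where \<open>n = CARD('n)\<close>; note that
  \<open>CARD('n) \<ge> 1\<close> holds for every finite type.
\<close>

instance bit :: finite
proof
  have "UNIV = {0, 1 :: bit}"
    by (auto intro: bit.exhaust)
  then show "finite (UNIV :: bit set)"
    by (metis finite.emptyI finite_insert)
qed

text \<open>
  A graph is a vertex set together with a set of unordered pairs of vertices. A singleton
  \<open>{v}\<close> is a loop at \<open>v\<close>; loops occur in a Cayley graph precisely when \<open>0 \<in> S\<close>.
\<close>

type_synonym 'a graph = "'a set \<times> 'a set set"

definition verts :: "'a graph \<Rightarrow> 'a set" where
  "verts G = fst G"

definition edges :: "'a graph \<Rightarrow> 'a set set" where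
  "edges G = snd G"

definition cayley_graph :: "'a::group_add set \<Rightarrow> 'a graph" where
  "cayley_graph S = (UNIV, {{g, g + s} | g s. s \<in> S})"

definition induced_subgraph :: "'a graph \<Rightarrow> 'a set \<Rightarrow> 'a graph" where
  "induced_subgraph G U = (U, {e \<in> edges G. e \<subseteq> U})"

text \<open>
  A loop contributes one to the degree of its vertex. This is the convention under which the
  degree of \<open>u\<close> in an induced subgraph of a Cayley graph is the number of \<open>s \<in> S\<close> with
  \<open>u + s \<in> U\<close>, also when \<open>0 \<in> S\<close>; see \<open>degree_induced_cayley_graph\<close> below.
\<close>

definition graph_degree :: "'a graph \<Rightarrow> 'a \<Rightarrow> nat" where
  "graph_degree H u = card {v \<in> verts H. {u, v} \<in> edges H}"

definition max_degree :: "'a graph \<Rightarrow> nat" where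
  "max_degree H = Max (graph_degree H ` verts H)"

lemma degree_induced_cayley_graph:
  fixes S U :: "(bit ^ 'n) set"
  assumes "u \<in> U"
  shows "graph_degree (induced_subgraph (cayley_graph S) U) u = card {s \<in> S. u + s \<in> U}"
proof -
  have cancel: "x + x + y = y" for x y :: "bit ^ 'n"
    by (simp add: vec_eq_iff)
  have cancel': "x + (x + y) = y" for x y :: "bit ^ 'n"
    using cancel[of x y] by (simp add: add.assoc)
  have edge: "{u, v} \<in> edges (cayley_graph S) \<longleftrightarrow> u + v \<in> S" for v
  proof
    assume "{u, v} \<in> edges (cayley_graph S)"
    then obtain g s where "s \<in> S" "{u, v} = {g, g + s}"
      by (auto simp: edges_def cayley_graph_def)
    then show "u + v \<in> S"
      by (auto simp: doubleton_eq_iff cancel' add.commute)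
  next
    assume "u + v \<in> S"
    moreover have "{u, v} = {u, u + (u + v)}"
      by (simp add: cancel')
    ultimately show "{u, v} \<in> edges (cayley_graph S)"
      unfolding edges_def cayley_graph_def snd_conv by blast
  qed
  have "{v \<in> verts (induced_subgraph (cayley_graph S) U).
          {u, v} \<in> edges (induced_subgraph (cayley_graph S) U)} = {v \<in> U. u + v \<in> S}"
    using assms edge by (auto simp: verts_def induced_subgraph_def edges_def)
  also have "\<dots> = (+) u ` {s \<in> S. u + s \<in> U}"
    by (force simp: cancel' image_iff intro: exI[of _ "u + _"])
  finally show ?thesis
    unfolding graph_degree_def by (simp add: card_image)
qed

end

theory Submission
  imports Defs
begin

text \<open>
  A subset \<open>T\<close> of \<open>bit ^ 'n\<close> is a vertex of a hypercube, and toggling membership of \<open>s \<in> S\<close>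
  changes \<open>y + \<Sum>T\<close> by \<open>s\<close>. Averaging over the translation \<open>y\<close> shows that for some \<open>y\<close> more than
  half of all \<open>T\<close> satisfy \<open>y + \<Sum>T \<in> U\<close>, so the theorem reduces to Huang's theorem for the
  hypercube with edges only in the directions of \<open>S\<close>. There a signed adjacency operator \<open>A\<close>
  satisfies \<open>A\<^sup>2 = |S|\<close>, and conjugation by the parity of \<open>T\<close> maps \<open>A\<close> to \<open>-A\<close>; hence the
  eigenspace of \<open>\<surd>|S|\<close> has half the full dimension and contains a nonzero vector supported
  on any set of more than half of the vertices. At an entry of such a vector of largest absolute
  value, the eigenvalue equation bounds the degree from below.
\<close>

definition flip :: "'a \<Rightarrow> 'a set \<Rightarrow> 'a set" where
  "flip s T = (if s \<in> T then T - {s} else insert s T)"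

lemma flip_flip: "flip s (flip s T) = T"
  by (auto simp: flip_def)

lemma flip_commute: "flip s (flip t T) = flip t (flip s T)"
  by (auto simp: flip_def)

lemma minus_one_power_card_flip:
  fixes T :: "'a::finite set"
  shows "(-1::real) ^ card (flip s T) = - ((-1) ^ card T)"
proof (cases "s \<in> T")
  case True
  then have "(-1::real) ^ card T = (-1) ^ Suc (card (T - {s}))"
    by (simp only: card.remove[OF finite])
  with True show ?thesis
    by (simp add: flip_def)
qed (simp add: flip_def)

text \<open>The injection \<open>to_nat\<close> serves only to order the directions. Counting the
  elements of \<open>T\<close> below \<open>s\<close> gives the signs familiar from Clifford algebra
  generators.\<close>

definition cube_sign :: "'a::finite \<Rightarrow> 'a set \<Rightarrow> real" where
  "cube_sign s T = (-1) ^ card {t \<in> T. to_nat t < to_nat s}"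

lemma cube_sign_square: "cube_sign s T * cube_sign s T = 1"
  by (simp add: cube_sign_def flip: power_add)

lemma abs_cube_sign: "\<bar>cube_sign s T\<bar> = 1"
  by (simp add: cube_sign_def power_abs)

lemma cube_sign_flip:
  "cube_sign t (flip s T) = (if to_nat s < to_nat t then - cube_sign t T else cube_sign t T)"
proof -
  have "{u \<in> flip s T. to_nat u < to_nat t} =
      (if to_nat s < to_nat t then flip s {u \<in> T. to_nat u < to_nat t}
       else {u \<in> T. to_nat u < to_nat t})"
    by (auto simp: flip_def)
  then show ?thesis
    by (simp add: cube_sign_def minus_one_power_card_flip)
qed

text \<open>Of two distinct directions exactly one precedes the other, so exactly one of the two
  flips changes the sign of the other direction. Hence the two routes between opposite corners of a
  square carry opposite signs.\<close>

lemma cube_sign_flip_antisym: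
  assumes "s \<noteq> t"
  shows "cube_sign t T * cube_sign s (flip t T) = - (cube_sign s T * cube_sign t (flip s T))"
proof -
  from assms have "to_nat s \<noteq> to_nat t"
    by simp
  then show ?thesis
    by (auto simp: cube_sign_flip)
qed

definition signed_adj :: "'a::finite set \<Rightarrow> real ^ 'a set \<Rightarrow> real ^ 'a set" where
  "signed_adj S f = (\<chi> T. \<Sum>s\<in>S. cube_sign s T * f $ flip s T)"

lemma linear_signed_adj: "linear (signed_adj S)"
  by (rule linearI)
    (simp_all add: signed_adj_def vec_eq_iff sum.distrib sum_distrib_left algebra_simps)

text \<open>The square counts signed walks of length two: going back and forth along one edge
  contributes 1, and the two orders of distinct directions cancel.\<close>

lemma signed_adj_signed_adj: "signed_adj S (signed_adj S f) = real (card S) *\<^sub>R f"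
proof (rule vec_eq_iff[THEN iffD2], rule allI)
  fix T
  define h where "h s t = cube_sign s T * cube_sign t (flip s T) * f $ flip t (flip s T)" for s t
  have diag: "h s s = f $ T" for s
    by (simp add: h_def cube_sign_flip cube_sign_square flip_flip)
  have off_diag: "h t s = - h s t" if "s \<noteq> t" for s t
    by (simp add: h_def cube_sign_flip_antisym[OF that] flip_commute[of s t])
  have sym: "h s t + h t s = (if s = t then 2 * f $ T else 0)" for s t
    using off_diag[of s t] by (cases "s = t") (simp_all add: diag)
  \<comment> \<open>Adding the transposed double sum pairs \<open>h s t\<close> with
    \<open>h t s\<close>, so the cancellation becomes termwise.\<close>
  have "2 * (\<Sum>s\<in>S. \<Sum>t\<in>S. h s t) = (\<Sum>s\<in>S. \<Sum>t\<in>S. h s t) + (\<Sum>s\<in>S. \<Sum>t\<in>S. h t s)"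
    using sum.swap[of h S S] by simp
  also have "\<dots> = (\<Sum>s\<in>S. \<Sum>t\<in>S. h s t + h t s)"
    by (simp add: sum.distrib)
  also have "\<dots> = 2 * (real (card S) * f $ T)"
    by (simp add: sym)
  finally have "(\<Sum>s\<in>S. \<Sum>t\<in>S. h s t) = real (card S) * f $ T"
    by simp
  then show "signed_adj S (signed_adj S f) $ T = (real (card S) *\<^sub>R f) $ T"
    by (simp add: signed_adj_def h_def sum_distrib_left mult.assoc)
qed

definition parity_twist :: "real ^ 'a::finite set \<Rightarrow> real ^ 'a set" where
  "parity_twist f = (\<chi> T. (-1) ^ card T * f $ T)"

lemma linear_parity_twist: "linear parity_twist"
  by (rule linearI) (simp_all add: parity_twist_def vec_eq_iff algebra_simps)

lemma parity_twist_parity_twist: "parity_twist (parity_twist f) = f"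
  by (simp add: parity_twist_def vec_eq_iff flip: mult.assoc power_add)

lemma signed_adj_parity_twist: "signed_adj S (parity_twist f) = - parity_twist (signed_adj S f)"
  by (simp add: signed_adj_def parity_twist_def vec_eq_iff minus_one_power_card_flip
      sum_distrib_left sum_negf mult.left_commute)

text \<open>Since the operator squares to \<open>card S\<close>, the whole space is the sum of its
  two eigenspaces. The parity twist is an involution exchanging them, so neither is larger than the
  other.\<close>

lemma eigenspace_dim_ge_half:
  fixes S :: "'a::finite set"
  assumes "S \<noteq> {}"
  shows "CARD('a set) \<le> 2 * dim {f. signed_adj S f = sqrt (card S) *\<^sub>R f}"
proof -
  define r where "r = sqrt (card S)"
  have r: "r \<noteq> 0" "r * r = card S"
    using assms by (simp_all add: r_def)
  interpret A: linear "signed_adj S"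
    by (rule linear_signed_adj)
  define P where "P = {f. signed_adj S f = r *\<^sub>R f}"
  define M where "M = {f. signed_adj S f = - (r *\<^sub>R f)}"
  have subP: "subspace P" and subM: "subspace M"
    by (auto simp: P_def M_def subspace_def A.add A.scale scaleR_add_right mult.commute)
  have "parity_twist ` P \<subseteq> M" "parity_twist ` M \<subseteq> P"
    by (auto simp: P_def M_def signed_adj_parity_twist
        linear_cmul[OF linear_parity_twist] linear_neg[OF linear_parity_twist])
  then have "M \<subseteq> parity_twist ` P"
    by (metis image_eqI image_subset_iff parity_twist_parity_twist subsetI)
  then have "dim M \<le> dim (parity_twist ` P)"
    by (rule dim_subset)
  also have "\<dots> \<le> dim P"
    by (rule dim_image_le[OF linear_parity_twist])
  finally have dimM: "dim M \<le> dim P" .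
  have "\<exists>g\<in>P. \<exists>h\<in>M. f = g + h" for f
  proof (intro bexI)
    \<comment> \<open>These are the projections of \<open>f\<close> to the eigenspaces of
      \<open>r\<close> and \<open>-r\<close>; the division uses \<open>r \<noteq> 0\<close>, which
      comes from \<open>S \<noteq> {}\<close>.\<close>
    let ?g = "(1 / (2 * r)) *\<^sub>R (r *\<^sub>R f + signed_adj S f)"
    let ?h = "(1 / (2 * r)) *\<^sub>R (r *\<^sub>R f - signed_adj S f)"
    show "f = ?g + ?h"
      using r by (simp flip: scaleR_add_right)
    show "?g \<in> P" "?h \<in> M"
      by (simp_all add: P_def M_def A.add A.diff A.scale signed_adj_signed_adj algebra_simps
          flip: r(2))
  qed
  then have "{g + h |g h. g \<in> P \<and> h \<in> M} = UNIV"
    by blast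
  then have "DIM(real ^ 'a set) \<le> dim P + dim M"
    using dim_sums_Int[OF subP subM] by simp
  with dimM show ?thesis
    by (simp add: P_def r_def)
qed

lemma eigenvector_supported_on:
  fixes S :: "'a::finite set" and X :: "'a set set"
  assumes "S \<noteq> {}" and "CARD('a set) < 2 * card X"
  obtains f where "f \<noteq> 0" "\<And>T. T \<notin> X \<Longrightarrow> f $ T = 0" "signed_adj S f = sqrt (card S) *\<^sub>R f"
proof -
  define P where "P = {f. signed_adj S f = sqrt (card S) *\<^sub>R f}"
  define Q where "Q = {f :: real ^ 'a set. \<forall>T. T \<notin> X \<longrightarrow> f $ T = 0}"
  interpret A: linear "signed_adj S"
    by (rule linear_signed_adj)
  have subP: "subspace P" and subQ: "subspace Q"
    by (auto simp: P_def Q_def subspace_def A.add A.scale scaleR_add_right mult.commute)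
  have "dim Q = card X"
    using dim_substandard_cart[where 'a = real and d = X] by (simp add: Q_def dim_vec_eq)
  moreover have "dim {g + h |g h. g \<in> P \<and> h \<in> Q} \<le> CARD('a set)"
    by (rule order_trans[OF dim_subset_UNIV]) simp
  \<comment> \<open>\<open>P\<close> has at least half the full dimension and \<open>Q\<close> more
    than half, so they cannot meet only in 0.\<close>
  ultimately have "dim (P \<inter> Q) \<noteq> 0"
    using dim_sums_Int[OF subP subQ] eigenspace_dim_ge_half[OF assms(1)] assms(2)
    unfolding P_def by linarith
  then obtain f where "f \<in> P \<inter> Q" "f \<noteq> 0"
    by auto
  then show thesis
    by (intro that[of f]) (auto simp: P_def Q_def)
qed

theorem hypercube_directions_degree:
  fixes S :: "'a::finite set" and X :: "'a set set"
  assumes "CARD('a set) < 2 * card X"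
  obtains T where "T \<in> X" "sqrt (card S) \<le> card {s \<in> S. flip s T \<in> X}"
proof (cases "S = {}")
  \<comment> \<open>The bound is 0 here, so any vertex of \<open>X\<close> will do; the eigenvector
    is available for nonempty \<open>S\<close>.\<close>
  case True
  from assms obtain T where "T \<in> X"
    by (cases "X = {}") auto
  with True show ?thesis
    by (intro that[of T]) auto
next
  case False
  obtain f where f: "f \<noteq> 0" "\<And>T. T \<notin> X \<Longrightarrow> f $ T = 0"
      "signed_adj S f = sqrt (card S) *\<^sub>R f"
    using eigenvector_supported_on[OF False assms] by blast
  obtain T where T: "\<And>T'. \<bar>f $ T'\<bar> \<le> \<bar>f $ T\<bar>"
    using ex_is_arg_min_if_finite[of UNIV "\<lambda>T. - \<bar>f $ T\<bar>"]
    by (auto simp: is_arg_min_linorder)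
  have "f $ T \<noteq> 0"
    using T f(1) by (auto simp: vec_eq_iff)
  have "sqrt (card S) * \<bar>f $ T\<bar> = \<bar>\<Sum>s\<in>S. cube_sign s T * f $ flip s T\<bar>"
    using arg_cong[OF f(3), of "\<lambda>g. \<bar>g $ T\<bar>"] by (simp add: signed_adj_def abs_mult)
  also have "\<dots> \<le> (\<Sum>s\<in>S. \<bar>f $ flip s T\<bar>)"
    by (rule order_trans[OF sum_abs]) (simp add: abs_mult abs_cube_sign)
  also have "\<dots> = (\<Sum>s | s \<in> S \<and> flip s T \<in> X. \<bar>f $ flip s T\<bar>)"
    by (rule sum.mono_neutral_right) (auto simp: f(2))
  also have "\<dots> \<le> card {s \<in> S. flip s T \<in> X} * \<bar>f $ T\<bar>"
    by (rule sum_bounded_above) (rule T)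
  finally have "sqrt (card S) \<le> card {s \<in> S. flip s T \<in> X}"
    using \<open>f $ T \<noteq> 0\<close> by simp
  moreover have "T \<in> X"
    using \<open>f $ T \<noteq> 0\<close> f(2) by blast
  ultimately show ?thesis
    by (rule that[rotated])
qed

lemma sum_flip:
  fixes T :: "(bit ^ 'n) set"
  shows "\<Sum>(flip s T) = \<Sum>T + s"
proof (cases "s \<in> T")
  case True
  \<comment> \<open>Each vector is its own negative, so removing \<open>s\<close> from a sum also
    amounts to adding it.\<close>
  have "x + s + s = x" for x
    by (simp add: vec_eq_iff add.assoc)
  with True show ?thesis
    by (simp add: flip_def sum.remove[of T s] add.commute add.left_commute)
qed (simp add: flip_def add.commute)

text \<open>Double counting of the pairs \<open>(y, T)\<close> with
  \<open>y + \<sigma> T \<in> U\<close>: each \<open>T\<close> admits exactly \<open>card U\<close>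
  translations \<open>y\<close>. The average is cross-multiplied to stay in the natural
  numbers.\<close>

lemma ex_translate_card_ge_average:
  fixes \<sigma> :: "'b::finite \<Rightarrow> 'a::{finite, group_add}" and U :: "'a set"
  shows "\<exists>y. CARD('b) * card U \<le> CARD('a) * card {T. y + \<sigma> T \<in> U}"
proof (rule ccontr)
  assume "\<not> ?thesis"
  then have "(\<Sum>y\<in>(UNIV::'a set). CARD('a) * card {T. y + \<sigma> T \<in> U})
      < (\<Sum>y\<in>(UNIV::'a set). CARD('b) * card U)"
    by (intro sum_strict_mono) (auto simp: not_le)
  moreover have "card {y. y + \<sigma> T \<in> U} = card U" for T
  proof -
    have "{y. y + \<sigma> T \<in> U} = (\<lambda>u. u - \<sigma> T) ` U"
      by (force simp: image_iff)
    then show ?thesis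
      by (simp add: card_image inj_on_def)
  qed
  then have "(\<Sum>y\<in>(UNIV::'a set). card {T. y + \<sigma> T \<in> U}) = CARD('b) * card U"
    using sum_multicount_gen[of "UNIV::'a set" "UNIV::'b set" "\<lambda>y T. y + \<sigma> T \<in> U" "\<lambda>_. card U"]
    by simp
  ultimately show False
    by (simp flip: sum_distrib_left)
qed

theorem theorem1p1:
  fixes S U :: "(bit ^ 'n) set"
  assumes "card U > 2 ^ (CARD('n) - 1)"
  shows "real (max_degree (induced_subgraph (cayley_graph S) U)) \<ge> sqrt (real (card S))"
proof -
  have "CARD(bit) = 2"
  proof -
    have "UNIV = {0, 1 :: bit}"
      by (auto intro: bit.exhaust)
    then have "CARD(bit) = card {0, 1 :: bit}"
      by (rule arg_cong)
    then show ?thesis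
      by (simp only: card_2_iff) auto
  qed
  \<comment> \<open>The subtraction in the exponent is not truncated, because
    \<open>CARD('n)\<close> is positive.\<close>
  then have "CARD(bit ^ 'n) = 2 * 2 ^ (CARD('n) - 1)"
    by (simp flip: power_Suc)
  with assms have half: "CARD(bit ^ 'n) < 2 * card U"
    by simp
  \<comment> \<open>The cube has one coordinate for each group element: \<open>T\<close> ranges over
    all subsets of \<open>bit ^ 'n\<close>, while edges will use only directions in
    \<open>S\<close>.\<close>
  obtain y where y: "CARD((bit ^ 'n) set) * card U
      \<le> CARD(bit ^ 'n) * card {T. y + \<Sum>T \<in> U}"
    using ex_translate_card_ge_average by blast
  define X where "X = {T. y + \<Sum>T \<in> U}"
  \<comment> \<open>Scaling \<open>half\<close> by the number of cube vertices makes it comparable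
    with \<open>y\<close>; the common factor \<open>CARD(bit ^ 'n)\<close> is then
    cancelled.\<close>
  have "CARD(bit ^ 'n) * CARD((bit ^ 'n) set) < 2 * card U * CARD((bit ^ 'n) set)"
    using half by (intro mult_strict_right_mono) (simp_all add: zero_less_card_finite)
  also have "\<dots> \<le> CARD(bit ^ 'n) * (2 * card X)"
    using y by (simp add: X_def algebra_simps)
  finally have "CARD((bit ^ 'n) set) < 2 * card X"
    by (metis mult_less_cancel1)
  then obtain T where T: "T \<in> X" "sqrt (card S) \<le> card {s \<in> S. flip s T \<in> X}"
    by (rule hypercube_directions_degree)
  define u where "u = y + \<Sum>T"
  have "u \<in> U"
    using T(1) by (simp add: X_def u_def)
  have "{s \<in> S. flip s T \<in> X} = {s \<in> S. u + s \<in> U}"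
    by (simp add: X_def u_def sum_flip add.assoc)
  with T(2) have "sqrt (card S) \<le> graph_degree (induced_subgraph (cayley_graph S) U) u"
    by (simp add: degree_induced_cayley_graph[OF \<open>u \<in> U\<close>])
  also have "graph_degree (induced_subgraph (cayley_graph S) U) u
      \<le> max_degree (induced_subgraph (cayley_graph S) U)"
    using \<open>u \<in> U\<close> by (simp add: max_degree_def verts_def induced_subgraph_def)
  finally show ?thesis
    by simp
qed

end
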